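(* Let $X$ be a (real or complex) infinite-dimensional separable Banach space and let $A$ be a hypercyclic linear operator in $X$ satisfying the following: $A$ is densely defined, each power $A^n$ ($n\in\mathbb N$) is a closed operator, and there exist a set $Y\subseteq C^\infty(A):=\bigcap_{n=1}^\infty D(A^n)$ dense in $X$ and a mapping $B:Y\to Y$ such that (1) for every $f\in Y$: $ABf=f$; and (2) for every $f\in Y$: $A^nf\to 0$ and $B^nf\to 0$ as $n\to\infty$. If there exists an inverse $A^{-1}$ which is a bounded linear operator on $X$ (i.e., defined on all of $X$), then $A^{-1}$ is hypercyclic.
   Context: Operators may be unbounded; $D(\cdot)$ denotes the domain of an operator. The mapping $B:Y\to Y$ is not assumed linear or continuous, and $Y$ is only a set. A linear operator $T$ in a Banach space $X$ is called hypercyclic if there is a nonzero vector $f\in\bigcap_{n=0}^\infty D(T^n)$ (with $T^0:=I$) whose orbit $\{T^nf\}_{n\ge 0}$ is dense in $X$. *)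

theory Defs
  imports "HOL-Analysis.Analysis"
begin

text \<open>
  Real and complex Banach spaces are treated uniformly: a field of class
  \<open>real_normed_field\<close> has a multiplicative norm, so it is isometrically isomorphic to the
  reals or the complex numbers. The type class \<open>banach\<close> only supplies the underlying real
  Banach space; the scalar multiplication of the field \<open>'k\<close> must extend the real one.
\<close>

locale banach_over = vector_space smul
  for smul :: "'k::real_normed_field \<Rightarrow> 'a::banach \<Rightarrow> 'a" +
  assumes scale_of_real: "smul (of_real r) x = r *\<^sub>R x"
    and norm_scale: "norm (smul c x) = norm c * norm x"

lemma banach_over_real: "banach_over ((*\<^sub>R) :: real \<Rightarrow> 'a::banach \<Rightarrow> 'a)"
  by unfold_locales (simp_all add: algebra_simps)

lemma banach_over_complex: "banach_over ((*) :: complex \<Rightarrow> complex \<Rightarrow> complex)"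
  by unfold_locales (simp_all add: algebra_simps norm_mult scaleR_conv_of_real)

text \<open>
  An operator in \<open>'a\<close> is a partial map \<open>T :: 'a \<rightharpoonup> 'a\<close>, its domain being \<open>dom T\<close>.
\<close>

definition linear_operator :: "('k::field \<Rightarrow> 'a::ab_group_add \<Rightarrow> 'a) \<Rightarrow> ('a \<rightharpoonup> 'a) \<Rightarrow> bool" where
  "linear_operator smul T \<longleftrightarrow>
     module.subspace smul (dom T) \<and>
     (\<forall>x\<in>dom T. \<forall>y\<in>dom T. T (x + y) = Some (the (T x) + the (T y))) \<and>
     (\<forall>c. \<forall>x\<in>dom T. T (smul c x) = Some (smul c (the (T x))))"

definition closed_operator :: "('a::topological_space \<rightharpoonup> 'a) \<Rightarrow> bool" where
  "closed_operator T \<longleftrightarrow> closed (Map.graph T)"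

definition densely_defined :: "('a::topological_space \<rightharpoonup> 'a) \<Rightarrow> bool" where
  "densely_defined T \<longleftrightarrow> closure (dom T) = UNIV"

definition bounded_linear_operator ::
    "('k::field \<Rightarrow> 'a::real_normed_vector \<Rightarrow> 'a) \<Rightarrow> ('a \<rightharpoonup> 'a) \<Rightarrow> bool" where
  "bounded_linear_operator smul T \<longleftrightarrow>
     linear_operator smul T \<and> dom T = UNIV \<and> (\<exists>K. \<forall>x. norm (the (T x)) \<le> K * norm x)"

definition inverse_operator :: "('a \<rightharpoonup> 'a) \<Rightarrow> ('a \<rightharpoonup> 'a) \<Rightarrow> bool" where
  "inverse_operator T S \<longleftrightarrow> Map.graph S = (Map.graph T)\<inverse>"

text \<open>The domain of a power is the maximal one, since \<open>\<circ>\<^sub>m\<close> composes partial maps.\<close>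

primrec op_power :: "('a \<rightharpoonup> 'a) \<Rightarrow> nat \<Rightarrow> ('a \<rightharpoonup> 'a)" where
  "op_power T 0 = Some"
| "op_power T (Suc n) = T \<circ>\<^sub>m op_power T n"

definition C_infinity :: "('a \<rightharpoonup> 'a) \<Rightarrow> 'a set" where
  "C_infinity T = (\<Inter>n\<in>{1..}. dom (op_power T n))"

definition hypercyclic ::
    "('k::field \<Rightarrow> 'a::real_normed_vector \<Rightarrow> 'a) \<Rightarrow> ('a \<rightharpoonup> 'a) \<Rightarrow> bool" where
  "hypercyclic smul T \<longleftrightarrow>
     linear_operator smul T \<and>
     (\<exists>f. f \<noteq> 0 \<and> f \<in> (\<Inter>n. dom (op_power T n)) \<and>
          closure (range (\<lambda>n. the (op_power T n f))) = UNIV)"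

end

theory Submission
  imports Defs
begin

text \<open>
  Put \<open>S = A\<inverse>\<close>, a continuous map. On \<open>Y\<close> it agrees with \<open>B\<close>, so \<open>S\<^sup>n \<rightarrow> 0\<close> pointwise on \<open>Y\<close>,
  and the maps \<open>A\<^sup>n\<close>, which are right inverses of the \<open>S\<^sup>n\<close>, also tend to \<open>0\<close> pointwise on \<open>Y\<close>.
  For \<open>y, z \<in> Y\<close> the vectors \<open>y + A\<^sup>n z\<close> tend to \<open>y\<close> while their images \<open>S\<^sup>n y + z\<close> tend to
  \<open>z\<close>, so \<open>S\<close> is topologically transitive, and Birkhoff's theorem gives a dense orbit.
\<close>

text \<open>Baire category: transitivity makes each set of points that some \<open>F n\<close> sends
  into a given ball open and dense, and countably many balls suffice to test density of an orbit.
  Iteration plays no part, so \<open>F\<close> may be any sequence of continuous maps.\<close>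

lemma Birkhoff_transitivity:
  fixes F :: "nat \<Rightarrow> 'a::complete_space \<Rightarrow> 'b::metric_space"
  assumes separable: "separable_space (euclidean :: 'b topology)"
    and cont: "\<And>n. continuous_on UNIV (F n)"
    and trans: "\<And>U V. open U \<Longrightarrow> open V \<Longrightarrow> U \<noteq> {} \<Longrightarrow> V \<noteq> {} \<Longrightarrow> \<exists>n. \<exists>x\<in>U. F n x \<in> V"
  shows "\<exists>x. closure (range (\<lambda>n. F n x)) = UNIV"
proof -
  obtain C :: "'b set" where C: "countable C" "closure C = UNIV"
    using separable by (auto simp: separable_space_def)
  \<comment> \<open>The centres \<open>q\<close> run through a countable dense set and the radii
    1/(k+1) shrink to 0, so a point common to all these sets has an orbit approaching every
    \<open>q\<close>.\<close>
  define G where "G = (\<lambda>(q, k). \<Union>n. F n -` ball q (1 / Suc k))"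
  have "(euclidean :: 'a topology) closure_of \<Inter>(G ` (C \<times> UNIV)) = topspace euclidean"
  proof (rule Baire_category)
    show "completely_metrizable_space (euclidean :: 'a topology)
        \<or> locally_compact_space (euclidean :: 'a topology) \<and> regular_space (euclidean :: 'a topology)"
      by (simp add: completely_metrizable_space_euclidean)
    show "countable (G ` (C \<times> UNIV))"
      using C by simp
    fix T assume "T \<in> G ` (C \<times> UNIV)"
    then obtain q k where T: "T = (\<Union>n. F n -` ball q (1 / Suc k))"
      by (auto simp: G_def)
    have "open T"
      unfolding T using cont by (intro open_UN ballI open_vimage) auto
    moreover have "x \<in> closure T" for x
    proof (unfold closure_iff_nhds_not_empty, intro allI impI)
      fix W U assume W: "U \<subseteq> W" "open U" "x \<in> U"
      then obtain n y where "y \<in> U" "F n y \<in> ball q (1 / Suc k)"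
        using trans[of U "ball q (1 / Suc k)"] by auto
      then have "y \<in> T \<inter> W"
        using W(1) unfolding T by blast
      then show "T \<inter> W \<noteq> {}"
        by blast
    qed
    ultimately show "openin euclidean T \<and> euclidean closure_of T = topspace euclidean"
      by auto
  qed
  \<comment> \<open>A type is never empty, so a dense subset of it has a point.\<close>
  then have "\<Inter>(G ` (C \<times> UNIV)) \<noteq> {}"
    by (metis UNIV_not_empty closure_of_empty topspace_euclidean)
  then obtain x where "\<And>p. p \<in> C \<times> UNIV \<Longrightarrow> x \<in> G p"
    by blast
  then have x: "\<exists>n. dist q (F n x) < 1 / Suc k" if "q \<in> C" for q k
    using that by (force simp: G_def)
  have "C \<subseteq> closure (range (\<lambda>n. F n x))"
  proof
    fix q assume q: "q \<in> C"
    show "q \<in> closure (range (\<lambda>n. F n x))"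
      unfolding closure_approachable
    proof (intro allI impI)
      fix e :: real assume "0 < e"
      then obtain k where "1 / Suc k < e"
        using nat_approx_posE by blast
      then show "\<exists>y\<in>range (\<lambda>n. F n x). dist y q < e"
        using x[OF q, of k] by (metis dist_commute less_trans rangeI)
    qed
  qed
  then have "closure C \<subseteq> closure (range (\<lambda>n. F n x))"
    by (simp add: closure_minimal)
  then show ?thesis
    using C by auto
qed

text \<open>The right inverses form a mere family \<open>R n\<close> of functions: the powers of an
  unbounded operator are partial, and \<open>R\<close> can hold arbitrary values off their
  domains.\<close>

lemma dense_orbit_criterion:
  fixes S :: "'a::banach \<Rightarrow> 'a" and R :: "nat \<Rightarrow> 'a \<Rightarrow> 'a"
  assumes separable: "separable_space (euclidean :: 'a topology)"
    and S: "bounded_linear S"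
    and Y: "closure Y = UNIV"
    and S_null: "\<And>y. y \<in> Y \<Longrightarrow> (\<lambda>n. (S ^^ n) y) \<longlonglongrightarrow> 0"
    and R_null: "\<And>y. y \<in> Y \<Longrightarrow> (\<lambda>n. R n y) \<longlonglongrightarrow> 0"
    and right_inverse: "\<And>y n. y \<in> Y \<Longrightarrow> (S ^^ n) (R n y) = y"
  shows "\<exists>x. closure (range (\<lambda>n. (S ^^ n) x)) = UNIV"
proof (rule Birkhoff_transitivity[OF separable])
  have bl: "bounded_linear (S ^^ n)" for n
  proof (induction n)
    case 0
    then show ?case
      by (simp add: id_def)
  next
    case (Suc n)
    then show ?case
      using bounded_linear_compose[OF S Suc] by (simp add: o_def)
  qed
  show "continuous_on UNIV (S ^^ n)" for n
    using bl linear_continuous_on by blast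
  fix U V :: "'a set"
  assume UV: "open U" "open V" "U \<noteq> {}" "V \<noteq> {}"
  obtain y where y: "y \<in> Y" "y \<in> U"
    using open_Int_closure_eq_empty[OF UV(1), of Y] Y UV(3) by auto
  obtain z where z: "z \<in> Y" "z \<in> V"
    using open_Int_closure_eq_empty[OF UV(2), of Y] Y UV(4) by auto
  have "(\<lambda>n. y + R n z) \<longlonglongrightarrow> y"
    using tendsto_add[OF tendsto_const R_null[OF z(1)], of y] by simp
  then have U: "\<forall>\<^sub>F n in sequentially. y + R n z \<in> U"
    using topological_tendstoD UV(1) y(2) by blast
  have "(S ^^ n) (y + R n z) = (S ^^ n) y + z" for n
    using right_inverse[OF z(1)] by (simp add: linear_add[OF bounded_linear.linear[OF bl]])
  then have "(\<lambda>n. (S ^^ n) (y + R n z)) \<longlonglongrightarrow> z"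
    using tendsto_add[OF S_null[OF y(1)] tendsto_const, of z] by simp
  then have "\<forall>\<^sub>F n in sequentially. (S ^^ n) (y + R n z) \<in> V"
    using topological_tendstoD UV(2) z(2) by blast
  \<comment> \<open>Both memberships hold for all large n, so a single n serves both.\<close>
  with U have "\<forall>\<^sub>F n in sequentially. y + R n z \<in> U \<and> (S ^^ n) (y + R n z) \<in> V"
    by (rule eventually_conj)
  then show "\<exists>n. \<exists>x\<in>U. (S ^^ n) x \<in> V"
    using eventually_happens'[OF sequentially_bot] by blast
qed

lemma op_power_total:
  assumes "\<And>x. T x = Some (S x)"
  shows "op_power T n x = Some ((S ^^ n) x)"
  by (induction n) (simp_all add: assms)

lemma dom_op_power_Suc_subset: "dom (op_power T (Suc n)) \<subseteq> dom (op_power T n)"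
  by (auto simp: map_comp_Some_iff)

text \<open>The last application of \<open>T\<close> is undone first, so \<open>y\<close> varies in
  the induction and \<open>funpow_swap1\<close> moves one \<open>S\<close> to the inside.\<close>

lemma funpow_left_inverse_op_power:
  assumes "\<And>x y. T x = Some y \<Longrightarrow> S y = x" "op_power T n x = Some y"
  shows "(S ^^ n) y = x"
  using assms(2)
proof (induction n arbitrary: y)
  case (Suc n)
  then obtain w where "op_power T n x = Some w" "T w = Some y"
    by (auto simp: map_comp_Some_iff)
  then show ?case
    using Suc.IH assms(1) by (simp add: funpow_swap1)
qed simp

lemma bounded_linear_operator_imp_bounded_linear:
  assumes "banach_over smul" "bounded_linear_operator smul T"
  shows "bounded_linear (\<lambda>x. the (T x))"
proof -
  interpret banach_over smul
    by fact
  have T: "T (x + y) = Some (the (T x) + the (T y))" "T (smul c x) = Some (smul c (the (T x)))"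
    for x y c
    using assms(2) by (auto simp: bounded_linear_operator_def linear_operator_def)
  obtain K where K: "\<And>x. norm (the (T x)) \<le> K * norm x"
    using assms(2) by (auto simp: bounded_linear_operator_def)
  show ?thesis
  proof (rule bounded_linear_intro)
    \<comment> \<open>Real homogeneity is the case of scalars \<open>of_real r\<close> in the field
      \<open>'k\<close>.\<close>
    show "the (T (r *\<^sub>R x)) = r *\<^sub>R the (T x)" for r x
      using T(2)[of "of_real r" x] by (simp add: scale_of_real)
    show "norm (the (T x)) \<le> norm x * K" for x
      using K by (simp add: mult.commute)
  qed (simp add: T(1))
qed

theorem corollary4p1:
  fixes smul :: "'k::real_normed_field \<Rightarrow> 'a::banach \<Rightarrow> 'a"
    and A A_inv :: "'a \<rightharpoonup> 'a"
    and Y :: "'a set"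
    and B :: "'a \<Rightarrow> 'a"
  assumes "banach_over smul"
    and infinite_dimensional: "\<not> (\<exists>S. finite S \<and> module.span smul S = UNIV)"
    and separable: "separable_space (euclidean :: 'a topology)"
    and "hypercyclic smul A"
    and "densely_defined A"
    and "\<And>n. n \<ge> 1 \<Longrightarrow> closed_operator (op_power A n)"
    and "Y \<subseteq> C_infinity A"
    and "closure Y = UNIV"
    and "B ` Y \<subseteq> Y"
    and "\<And>f. f \<in> Y \<Longrightarrow> A (B f) = Some f"
    and "\<And>f. f \<in> Y \<Longrightarrow> (\<lambda>n. the (op_power A n f)) \<longlonglongrightarrow> 0"
    and "\<And>f. f \<in> Y \<Longrightarrow> (\<lambda>n. (B ^^ n) f) \<longlonglongrightarrow> 0"
    and "inverse_operator A A_inv"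
    and "bounded_linear_operator smul A_inv"
  shows "hypercyclic smul A_inv"
proof -
  interpret banach_over smul
    by fact
  define S where "S = (\<lambda>x. the (A_inv x))"
  define R where "R = (\<lambda>n x. the (op_power A n x))"
  have A_inv: "A_inv x = Some (S x)" for x
  proof -
    have "x \<in> dom A_inv"
      using assms(14) by (simp add: bounded_linear_operator_def)
    then show ?thesis
      by (auto simp: S_def)
  qed
  have AS: "S y = x" if "A x = Some y" for x y
  proof -
    have "(y, x) \<in> Map.graph A_inv"
      using assms(13) that by (auto simp: inverse_operator_def intro: in_graphI)
    then show ?thesis
      by (auto simp: A_inv dest: in_graphD)
  qed
  \<comment> \<open>From \<open>A (B f) = Some f\<close> follows \<open>S f = B f\<close> on
    \<open>Y\<close>. Membership in \<open>Y\<close> is carried along so that this applies to the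
    next iterate.\<close>
  have BS: "(B ^^ n) y = (S ^^ n) y \<and> (B ^^ n) y \<in> Y" if "y \<in> Y" for n y
  proof (induction n)
    case (Suc n)
    then show ?case
      using AS[OF assms(10), of "(B ^^ n) y"] assms(9) by auto
  qed (simp add: that)
  have S_null: "(\<lambda>n. (S ^^ n) y) \<longlonglongrightarrow> 0" if "y \<in> Y" for y
    using assms(12)[OF that] BS[OF that] by simp
  have R_dom: "op_power A n y = Some (R n y)" if "y \<in> Y" for n y
  proof -
    \<comment> \<open>\<open>C_infinity\<close> intersects only over exponents from 1 on. Passing
      through \<open>Suc n\<close> and the nested domains covers n = 0 as well.\<close>
    have "y \<in> dom (op_power A (Suc n))"
      using assms(7) that by (auto simp: C_infinity_def simp del: op_power.simps)
    then show ?thesis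
      using dom_op_power_Suc_subset[of A n] by (auto simp: R_def simp del: op_power.simps)
  qed
  have S_bl: "bounded_linear S"
    unfolding S_def by (rule bounded_linear_operator_imp_bounded_linear[OF assms(1,14)])
  have "\<exists>f. closure (range (\<lambda>n. (S ^^ n) f)) = UNIV"
  proof (rule dense_orbit_criterion[OF separable S_bl assms(8) S_null])
    show "(\<lambda>n. R n y) \<longlonglongrightarrow> 0" if "y \<in> Y" for y
      unfolding R_def by (rule assms(11)[OF that])
    show "(S ^^ n) (R n y) = y" if "y \<in> Y" for y n
      by (rule funpow_left_inverse_op_power[of A S, OF AS R_dom[OF that]])
  qed
  then obtain f where f: "closure (range (\<lambda>n. (S ^^ n) f)) = UNIV"
    by blast
  \<comment> \<open>The orbit of 0 is {0}, which is closed; its density would make the space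
    trivial, hence spanned by the empty set.\<close>
  have "f \<noteq> 0"
  proof
    assume "f = 0"
    have "S 0 = 0"
      by (rule linear_0[OF bounded_linear.linear[OF S_bl]])
    then have "(S ^^ n) 0 = 0" for n
      by (induction n) simp_all
    then have "(UNIV :: 'a set) = {0}"
      using f \<open>f = 0\<close> by simp
    then have "span {} = UNIV"
      by simp
    then show False
      using infinite_dimensional by blast
  qed
  then show ?thesis
    using assms(14) f op_power_total[of A_inv S, OF A_inv]
    by (auto simp: hypercyclic_def bounded_linear_operator_def)
qed

end
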